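(* Let $\mathcal{D}$ be a compact subset of $\mathbb{C}\setminus\{0\}$. For $a_0\in\mathcal{D}$ let $H(r)=-a_0+\sum_{k=1}^{\infty}a_k r^k$, $a_k=a_k(a_0)$, be the unique formal power series solution with $H(0)=-a_0$ of $$H''(r)=\frac{(H'(r))^2}{H(r)}-\frac{H'(r)}{r}+\frac1r\left((H(r))^2-\frac{1}{H(r)}\right).$$ Then this series is uniformly convergent for $a_0\in\mathcal{D}$, in the disc $|r|<1/R$, where $R>0$ is any number for which there is $N>0$ such that $|a_n(a_0)|<N R^n/n^2$ for all $n\in\mathbb{N}$ and all $a_0\in\mathcal{D}$; and such $N$ and $R$ exist.
   Context: The prime denotes differentiation with respect to $r$. For every $a_0\in\mathbb{C}\setminus\{0\}$ the differential equation has exactly one formal power series solution in $r$ with constant term $-a_0$. *)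

theory Defs
  imports "HOL-Analysis.Analysis" "HOL-Computational_Algebra.Formal_Laurent_Series"
begin

(* The individual terms of the right-hand side have a pole at r = 0 in general, so the equation
   is read in the field of formal Laurent series, with r being fls_X. *)
definition solves_ode :: "complex fps \<Rightarrow> bool" where
  "solves_ode H \<longleftrightarrow>
     (let h = fps_to_fls H; h' = fps_to_fls (fps_deriv H); h'' = fps_to_fls (fps_deriv (fps_deriv H))
      in h'' = h'\<^sup>2 / h - h' / fls_X + 1 / fls_X * (h\<^sup>2 - 1 / h))"

(* Well defined for a0 \<noteq> 0, see ex1_solution below. *)
definition H_series :: "complex \<Rightarrow> complex fps" where
  "H_series a0 = (THE H. fps_nth H 0 = - a0 \<and> solves_ode H)"

definition coeff_bound :: "complex set \<Rightarrow> real \<Rightarrow> real \<Rightarrow> bool" where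
  "coeff_bound D N R \<longleftrightarrow>
     (\<forall>n\<ge>1. \<forall>a0\<in>D. cmod (fps_nth (H_series a0) n) < N * R ^ n / (real n)\<^sup>2)"

lemma ode_cleared:
  fixes x h h' h'' :: "'a :: field"
  assumes "x \<noteq> 0" "h \<noteq> 0"
  shows "h'' = h'\<^sup>2 / h - h' / x + 1 / x * (h\<^sup>2 - 1 / h) \<longleftrightarrow>
    h * (x * h'' + h') = x * h'\<^sup>2 + h ^ 3 - 1"
proof -
  have "h'' = h'\<^sup>2 / h - h' / x + 1 / x * (h\<^sup>2 - 1 / h) \<longleftrightarrow>
    x * h * h'' = x * h * (h'\<^sup>2 / h - h' / x + 1 / x * (h\<^sup>2 - 1 / h))"
    using assms by simp
  also have "x * h * (h'\<^sup>2 / h - h' / x + 1 / x * (h\<^sup>2 - 1 / h)) = x * h'\<^sup>2 + h ^ 3 - 1 - h * h'"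
    using assms by (simp add: field_simps power2_eq_square power3_eq_cube)
  finally show ?thesis by (simp add: algebra_simps)
qed

lemma solves_ode_iff:
  assumes "fps_nth H 0 \<noteq> 0"
  shows "solves_ode H \<longleftrightarrow>
    H * (fps_X * fps_deriv (fps_deriv H) + fps_deriv H) = fps_X * (fps_deriv H)\<^sup>2 + H ^ 3 - 1"
proof -
  have nz: "fps_to_fls H \<noteq> 0" using assms by auto
  have "solves_ode H \<longleftrightarrow>
      fps_to_fls (H * (fps_X * fps_deriv (fps_deriv H) + fps_deriv H)) =
      fps_to_fls (fps_X * (fps_deriv H)\<^sup>2 + H ^ 3 - 1)"
    unfolding solves_ode_def Let_def
    by (simp only: ode_cleared[OF fls_X_nonzero nz] fls_times_fps_to_fls fps_to_fls_plus
        fps_to_fls_minus fps_X_to_fls fps_to_fls_power fps_one_to_fls)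
  thus ?thesis by (simp only: fps_to_fls_eq_iff)
qed

definition ode_rest :: "complex fps \<Rightarrow> nat \<Rightarrow> complex" where
  "ode_rest H n = fps_nth (fps_X * (fps_deriv H)\<^sup>2 + H ^ 3 - 1) n
     - (\<Sum>k<n. (of_nat (Suc k))\<^sup>2 * fps_nth H (Suc k) * fps_nth H (n - k))"

lemma solves_ode_iff_recurrence:
  assumes "fps_nth H 0 \<noteq> 0"
  shows "solves_ode H \<longleftrightarrow>
    (\<forall>n. (of_nat (Suc n))\<^sup>2 * fps_nth H (Suc n) * fps_nth H 0 = ode_rest H n)"
proof -
  have "fps_nth (H * (fps_X * fps_deriv (fps_deriv H) + fps_deriv H)) n =
     (\<Sum>k<n. (of_nat (Suc k))\<^sup>2 * fps_nth H (Suc k) * fps_nth H (n - k))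
     + (of_nat (Suc n))\<^sup>2 * fps_nth H (Suc n) * fps_nth H 0" for n
  proof -
    have *: "fps_nth (fps_X * fps_deriv (fps_deriv H) + fps_deriv H) k =
      (of_nat (Suc k))\<^sup>2 * fps_nth H (Suc k)" for k
      by (cases k) (simp_all add: power2_eq_square algebra_simps)
    have "fps_nth ((fps_X * fps_deriv (fps_deriv H) + fps_deriv H) * H) n =
      (\<Sum>k=0..n. (of_nat (Suc k))\<^sup>2 * fps_nth H (Suc k) * fps_nth H (n - k))"
      by (simp only: fps_mult_nth *)
    also have "{0..n} = insert n {..<n}" by auto
    finally show ?thesis by (simp add: mult.commute[of H] add.commute)
  qed
  thus ?thesis
    unfolding solves_ode_iff[OF assms] fps_eq_iff ode_rest_def
    by (simp only: eq_diff_eq add.commute)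
qed

lemma ode_rest_cong:
  assumes "\<And>k. k \<le> n \<Longrightarrow> fps_nth G k = fps_nth H k"
  shows "ode_rest G n = ode_rest H n"
proof -
  have mult: "fps_nth (A * B) m = fps_nth (A' * B') m"
    if "\<And>k. k \<le> m \<Longrightarrow> fps_nth A k = fps_nth A' k" "\<And>k. k \<le> m \<Longrightarrow> fps_nth B k = fps_nth B' k"
    for A B A' B' :: "complex fps" and m
    unfolding fps_mult_nth using that by (intro sum.cong) auto
  have "fps_nth (G ^ 3) n = fps_nth (H ^ 3) n"
    unfolding power3_eq_cube using assms by (intro mult) auto
  moreover have "fps_nth (fps_X * (fps_deriv G)\<^sup>2) n = fps_nth (fps_X * (fps_deriv H)\<^sup>2) n"
  proof (cases n)
    case (Suc m)
    have "fps_nth ((fps_deriv G)\<^sup>2) m = fps_nth ((fps_deriv H)\<^sup>2) m"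
      unfolding power2_eq_square using assms Suc by (intro mult) auto
    thus ?thesis using Suc by simp
  qed simp
  ultimately show ?thesis
    unfolding ode_rest_def using assms by (auto intro!: sum.cong)
qed

lemma ex1_solution:
  assumes "a0 \<noteq> 0"
  shows "\<exists>!H. fps_nth H 0 = - a0 \<and> solves_ode H"
proof (rule ex_ex1I)
  define P where "P = (\<lambda>(f :: nat \<Rightarrow> complex) n v. case n of 0 \<Rightarrow> v = - a0
     | Suc m \<Rightarrow> (of_nat (Suc m))\<^sup>2 * v * (- a0) = ode_rest (Abs_fps f) m)"
  have "\<exists>f. \<forall>n. P f n (f n)"
  proof (rule dependent_wf_choice[of less_than])
    show "P f n r = P g n r" if "\<And>z. (z, n) \<in> less_than \<Longrightarrow> f z = g z" for f g n r
      using that ode_rest_cong[of _ "Abs_fps f" "Abs_fps g"]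
      by (auto simp: P_def split: nat.split)
    show "\<exists>r. P f n r" for n f
    proof (cases n)
      case (Suc m)
      have "P f n (ode_rest (Abs_fps f) m / ((of_nat (Suc m))\<^sup>2 * (- a0)))"
        using assms Suc by (simp add: P_def del: of_nat_Suc)
      thus ?thesis ..
    qed (simp add: P_def)
  qed simp
  then obtain f where f: "P f n (f n)" for n by blast
  have "f 0 = - a0" using f[of 0] by (simp add: P_def)
  moreover have "(of_nat (Suc n))\<^sup>2 * f (Suc n) * f 0 = ode_rest (Abs_fps f) n" for n
    using f[of "Suc n"] calculation by (simp add: P_def)
  ultimately have "fps_nth (Abs_fps f) 0 = - a0 \<and> solves_ode (Abs_fps f)"
    using assms by (subst solves_ode_iff_recurrence) auto
  thus "\<exists>H. fps_nth H 0 = - a0 \<and> solves_ode H" ..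
next
  fix G H assume G: "fps_nth G 0 = - a0 \<and> solves_ode G" and H: "fps_nth H 0 = - a0 \<and> solves_ode H"
  have "fps_nth G n = fps_nth H n" for n
  proof (induction n rule: less_induct)
    case (less n)
    show ?case
    proof (cases n)
      case (Suc m)
      have "ode_rest G m = ode_rest H m" using less Suc by (intro ode_rest_cong) auto
      hence "(of_nat (Suc m))\<^sup>2 * fps_nth G (Suc m) * (- a0) = (of_nat (Suc m))\<^sup>2 * fps_nth H (Suc m) * (- a0)"
        using G H assms solves_ode_iff_recurrence[of G] solves_ode_iff_recurrence[of H] by simp
      thus ?thesis using assms Suc by (simp del: of_nat_Suc)
    qed (use G H in simp)
  qed
  thus "G = H" by (simp add: fps_eq_iff)
qed

lemma H_series:
  assumes "a0 \<noteq> 0"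
  shows "fps_nth (H_series a0) 0 = - a0" "solves_ode (H_series a0)"
  using theI'[OF ex1_solution[OF assms]] by (simp_all add: H_series_def)

end

theory Submission
  imports Defs
begin

text \<open>
  The bound is propagated by strong induction through the recurrence for the coefficients. The
  quadratic part of the recurrence involving derivatives contributes at most \<open>4 N\<^sup>2 R ^ (n + 1)\<close>,
  which is absorbed by taking \<open>N\<close> small in terms of the distance of \<open>D\<close> to \<open>0\<close>; the cube and the
  constant only carry \<open>R ^ n\<close>, so they are absorbed by then taking \<open>R\<close> large.
\<close>

section \<open>Finite sums of inverse squares\<close>

lemma sum_inverse_squares_le: "(\<Sum>k<n. 1 / (real (Suc k))\<^sup>2) \<le> 2"
proof -
  \<comment> \<open>The strengthened bound makes the induction telescope through 1/(n+1)^2 \<le> 1/n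
    - 1/(n+1), an estimate that needs \<open>n > 0\<close>.\<close>
  have "(\<Sum>k<n. 1 / (real (Suc k))\<^sup>2) \<le> 2 - 1 / real n" if "n > 0"
    using that
  proof (induction n rule: nat_induct_non_zero)
    case (Suc n)
    have "1 / (real (Suc n))\<^sup>2 \<le> 1 / (real n * real (Suc n))"
      using Suc.hyps by (intro divide_left_mono) (auto simp: power2_eq_square)
    also have "\<dots> = 1 / real n - 1 / real (Suc n)"
      using Suc.hyps by (simp add: field_simps)
    finally show ?case using Suc.IH by simp
  qed simp
  thus ?thesis by (cases "n = 0") (auto intro: order_trans)
qed

lemma sum_inverse_squares_rev_le: "(\<Sum>k<n. 1 / (real (n - k))\<^sup>2) \<le> 2"
proof -
  have "(\<Sum>k<n. 1 / (real (n - k))\<^sup>2) = (\<Sum>k<n. 1 / (real (Suc (n - Suc k)))\<^sup>2)"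
    by (intro sum.cong) (auto simp: Suc_diff_Suc)
  also have "\<dots> = (\<Sum>k<n. 1 / (real (Suc k))\<^sup>2)"
    by (rule sum.nat_diff_reindex)
  finally show ?thesis using sum_inverse_squares_le by simp
qed

text \<open>By the arithmetic-geometric mean inequality each mixed product is at most the mean of
  two inverse squares, whose sums are both at most 2.\<close>

lemma sum_inverse_products_le: "(\<Sum>k<n. 1 / (real (Suc k) * real (n - k))) \<le> 2"
proof -
  have "1 / (x * y) \<le> (1 / x\<^sup>2 + 1 / y\<^sup>2) / 2" for x y :: real
    using sum_squares_bound[of "1 / x" "1 / y"] by (simp add: power_divide)
  hence "(\<Sum>k<n. 1 / (real (Suc k) * real (n - k)))
      \<le> (\<Sum>k<n. (1 / (real (Suc k))\<^sup>2 + 1 / (real (n - k))\<^sup>2) / 2)"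
    by (intro sum_mono)
  also have "\<dots> = ((\<Sum>k<n. 1 / (real (Suc k))\<^sup>2) + (\<Sum>k<n. 1 / (real (n - k))\<^sup>2)) / 2"
    by (simp only: sum.distrib flip: sum_divide_distrib)
  also have "\<dots> \<le> (2 + 2) / 2"
    by (intro divide_right_mono add_mono sum_inverse_squares_le sum_inverse_squares_rev_le) simp
  also have "\<dots> = (2 :: real)" by simp
  finally show ?thesis .
qed

section \<open>Coefficients of products and cubes of power series\<close>

text \<open>Inverse square decay of one factor suffices to keep the convolution from growing with
  \<open>n\<close>. In the constant 3, index 0 of \<open>A\<close> contributes 1 and the sum of
  inverse squares 2. The resulting bound has the form required of \<open>B\<close>, so the estimate
  can be iterated.\<close>

lemma norm_fps_mult_nth_le:
  fixes A B :: "'a :: real_normed_field fps"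
  assumes A0: "norm (fps_nth A 0) \<le> K"
    and A: "\<And>k. 1 \<le> k \<Longrightarrow> k \<le> n \<Longrightarrow> norm (fps_nth A k) \<le> K * R ^ k / (real k)\<^sup>2"
    and B: "\<And>k. k \<le> n \<Longrightarrow> norm (fps_nth B k) \<le> L * R ^ k"
    and nonneg: "K \<ge> 0" "L \<ge> 0" "R \<ge> 0"
  shows "norm (fps_nth (A * B) n) \<le> 3 * K * L * R ^ n"
proof -
  have 0: "norm (fps_nth A 0 * fps_nth B n) \<le> K * L * R ^ n"
    using mult_mono[OF A0 B[of n]] nonneg by (simp add: norm_mult mult.assoc)
  have S: "norm (fps_nth A (Suc k) * fps_nth B (n - Suc k)) \<le> K * L * R ^ n * (1 / (real (Suc k))\<^sup>2)"
    if "k < n" for k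
  proof -
    have "norm (fps_nth A (Suc k) * fps_nth B (n - Suc k))
        \<le> (K * R ^ Suc k / (real (Suc k))\<^sup>2) * (L * R ^ (n - Suc k))"
      unfolding norm_mult using that nonneg by (intro mult_mono A B) auto
    also have "\<dots> = K * L * (R ^ Suc k * R ^ (n - Suc k)) * (1 / (real (Suc k))\<^sup>2)"
      by (simp add: mult_ac)
    also have "R ^ Suc k * R ^ (n - Suc k) = R ^ n"
      using that by (simp flip: power_add power_Suc)
    finally show ?thesis .
  qed
  have "fps_nth (A * B) n = (\<Sum>i\<le>n. fps_nth A i * fps_nth B (n - i))"
    by (simp add: fps_mult_nth atLeast0AtMost)
  also have "\<dots> = fps_nth A 0 * fps_nth B n + (\<Sum>k<n. fps_nth A (Suc k) * fps_nth B (n - Suc k))"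
    by (subst sum.atMost_shift) simp
  also have "norm \<dots> \<le> K * L * R ^ n + (\<Sum>k<n. K * L * R ^ n * (1 / (real (Suc k))\<^sup>2))"
    by (intro norm_triangle_mono 0 sum_norm_le) (use S in auto)
  also have "\<dots> = K * L * R ^ n * (1 + (\<Sum>k<n. 1 / (real (Suc k))\<^sup>2))"
    by (simp only: distrib_left sum_distrib_left mult_1_right)
  also have "\<dots> \<le> K * L * R ^ n * 3"
    using sum_inverse_squares_le[of n] nonneg by (intro mult_left_mono) auto
  finally show ?thesis by (simp add: mult_ac)
qed

text \<open>Two applications of the product estimate give 3 * 3 = 9. The inner product
  \<open>A * A\<close> has lost the inverse square decay, so it serves as the second factor of the
  outer one.\<close>

lemma norm_fps_power3_nth_le:
  fixes A :: "'a :: real_normed_field fps"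
  assumes A0: "norm (fps_nth A 0) \<le> K"
    and A: "\<And>k. 1 \<le> k \<Longrightarrow> k \<le> n \<Longrightarrow> norm (fps_nth A k) \<le> K * R ^ k / (real k)\<^sup>2"
    and nonneg: "K \<ge> 0" "R \<ge> 0"
  shows "norm (fps_nth (A ^ 3) n) \<le> 9 * K ^ 3 * R ^ n"
proof -
  have A': "norm (fps_nth A k) \<le> K * R ^ k" if "k \<le> n" for k
  proof (cases k)
    case (Suc j)
    have "norm (fps_nth A k) \<le> K * R ^ k / (real k)\<^sup>2" using that Suc by (intro A) auto
    also have "\<dots> \<le> K * R ^ k / 1"
      using nonneg Suc by (intro divide_left_mono) auto
    finally show ?thesis by simp
  qed (use A0 in simp)
  have "norm (fps_nth (A * A) k) \<le> (3 * K * K) * R ^ k" if "k \<le> n" for k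
    using that by (intro norm_fps_mult_nth_le A0 A A' nonneg) auto
  with A0 A have "norm (fps_nth (A * (A * A)) n) \<le> 3 * K * (3 * K * K) * R ^ n"
    by (rule norm_fps_mult_nth_le) (use nonneg in auto)
  thus ?thesis by (simp add: power3_eq_cube mult_ac)
qed

section \<open>Induction through the recurrence for the coefficients\<close>

text \<open>This is the same range and pairing of indices as in the sum of \<open>ode_rest\<close>.
  All indices lie between 1 and \<open>n\<close>, so the constant term does not enter.\<close>

lemma fps_X_mult_deriv_square_nth:
  fixes H :: "'a :: comm_ring_1 fps"
  shows "fps_nth (fps_X * (fps_deriv H)\<^sup>2) n =
    (\<Sum>k<n. of_nat (Suc k) * of_nat (n - k) * fps_nth H (Suc k) * fps_nth H (n - k))"
proof (cases n)
  case (Suc p)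
  have "fps_nth (fps_X * (fps_deriv H)\<^sup>2) n = fps_nth (fps_deriv H * fps_deriv H) p"
    by (simp add: Suc power2_eq_square)
  also have "\<dots> = (\<Sum>k=0..p. fps_nth (fps_deriv H) k * fps_nth (fps_deriv H) (p - k))"
    by (rule fps_mult_nth)
  also have "\<dots> = (\<Sum>k<n. of_nat (Suc k) * of_nat (n - k) * fps_nth H (Suc k) * fps_nth H (n - k))"
    by (intro sum.cong) (auto simp: Suc Suc_diff_le mult_ac simp del: of_nat_Suc)
  finally show ?thesis .
qed simp

text \<open>Only the bounds \<open>m\<close> and \<open>K\<close> on the constant term enter the
  choice of \<open>N\<close> and \<open>R\<close>, so one choice can serve a whole family of
  solutions. The hypothesis \<open>small\<close> is what the induction step demands once
  \<open>R ^ n\<close> is cancelled.\<close>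

lemma solves_ode_coeff_bound:
  assumes sol: "solves_ode H"
    and m: "0 < m" "m \<le> cmod (fps_nth H 0)" and K: "1 \<le> K" "cmod (fps_nth H 0) \<le> K"
    and N: "0 < N" "N \<le> 1" and R: "0 < R" "1 \<le> R"
    and small: "4 * N\<^sup>2 * R + (9 * K ^ 3 + 1) < m * N * R"
    and n: "1 \<le> n"
  shows "cmod (fps_nth H n) < N * R ^ n / (real n)\<^sup>2"
  using n
proof (induction n rule: less_induct)
  case (less n')
  \<comment> \<open>The first coefficient is the instance \<open>n = 0\<close>, where both
    convolution sums are empty.\<close>
  then obtain n where n': "n' = Suc n" by (cases n') auto
  define b where "b = fps_nth H"
  define Q where "Q = N\<^sup>2 * R ^ Suc n"
  have "b 0 \<noteq> 0" using m by (auto simp: b_def)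
  have b: "cmod (b k) \<le> N * R ^ k / (real k)\<^sup>2" if "1 \<le> k" "k \<le> n" for k
    using less.IH[of k] that n' by (simp add: b_def less_imp_le)
  \<comment> \<open>Both indices are positive and at most \<open>n\<close>, so the induction
    hypothesis applies to each factor; they add up to \<open>Suc n\<close>, which gives the power of
    \<open>R\<close> in \<open>Q\<close>.\<close>
  have bb: "cmod (b (Suc k) * b (n - k)) \<le> Q / ((real (Suc k))\<^sup>2 * (real (n - k))\<^sup>2)"
    if "k < n" for k
  proof -
    have "cmod (b (Suc k) * b (n - k)) \<le>
        (N * R ^ Suc k / (real (Suc k))\<^sup>2) * (N * R ^ (n - k) / (real (n - k))\<^sup>2)"
      unfolding norm_mult using that N R by (intro mult_mono b) auto
    also have "\<dots> = N\<^sup>2 * (R ^ Suc k * R ^ (n - k)) / ((real (Suc k))\<^sup>2 * (real (n - k))\<^sup>2)"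
      by (simp add: power2_eq_square mult_ac)
    also have "R ^ Suc k * R ^ (n - k) = R ^ Suc n"
      using that by (simp flip: power_add)
    finally show ?thesis by (simp add: Q_def)
  qed
  \<comment> \<open>The weight cancels one inverse square completely and leaves the other.\<close>
  have "cmod (\<Sum>k<n. (of_nat (Suc k))\<^sup>2 * b (Suc k) * b (n - k)) \<le>
      (\<Sum>k<n. Q * (1 / (real (n - k))\<^sup>2))"
  proof (intro sum_norm_le)
    fix k assume k: "k \<in> {..<n}"
    have "cmod ((of_nat (Suc k))\<^sup>2 * b (Suc k) * b (n - k)) =
        (real (Suc k))\<^sup>2 * cmod (b (Suc k) * b (n - k))"
      by (simp add: norm_mult norm_power del: of_nat_Suc)
    also have "\<dots> \<le> (real (Suc k))\<^sup>2 * (Q / ((real (Suc k))\<^sup>2 * (real (n - k))\<^sup>2))"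
      using bb k by (intro mult_left_mono) auto
    finally show "cmod ((of_nat (Suc k))\<^sup>2 * b (Suc k) * b (n - k)) \<le> Q * (1 / (real (n - k))\<^sup>2)"
      by (simp del: of_nat_Suc)
  qed
  also have "\<dots> = Q * (\<Sum>k<n. 1 / (real (n - k))\<^sup>2)"
    by (simp only: sum_distrib_left)
  also have "\<dots> \<le> Q * 2"
    using R by (intro mult_left_mono sum_inverse_squares_rev_le) (simp add: Q_def)
  finally have 1: "cmod (\<Sum>k<n. (of_nat (Suc k))\<^sup>2 * b (Suc k) * b (n - k)) \<le> Q * 2" .
  \<comment> \<open>Here the weight cancels one power from each inverse square instead.\<close>
  have "cmod (\<Sum>k<n. of_nat (Suc k) * of_nat (n - k) * b (Suc k) * b (n - k)) \<le>
      (\<Sum>k<n. Q * (1 / (real (Suc k) * real (n - k))))"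
  proof (intro sum_norm_le)
    fix k assume k: "k \<in> {..<n}"
    have "cmod (of_nat (Suc k) * of_nat (n - k) * b (Suc k) * b (n - k)) =
        real (Suc k) * real (n - k) * cmod (b (Suc k) * b (n - k))"
      by (simp add: norm_mult del: of_nat_Suc)
    also have "\<dots> \<le> real (Suc k) * real (n - k) * (Q / ((real (Suc k))\<^sup>2 * (real (n - k))\<^sup>2))"
      using bb k by (intro mult_left_mono) auto
    finally show "cmod (of_nat (Suc k) * of_nat (n - k) * b (Suc k) * b (n - k)) \<le>
        Q * (1 / (real (Suc k) * real (n - k)))"
      using k by (simp add: power2_eq_square del: of_nat_Suc)
  qed
  also have "\<dots> = Q * (\<Sum>k<n. 1 / (real (Suc k) * real (n - k)))"
    by (simp only: sum_distrib_left)
  also have "\<dots> \<le> Q * 2"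
    using R by (intro mult_left_mono sum_inverse_products_le) (simp add: Q_def)
  finally have 2: "cmod (fps_nth (fps_X * (fps_deriv H)\<^sup>2) n) \<le> Q * 2"
    by (simp only: fps_X_mult_deriv_square_nth b_def)
  \<comment> \<open>The cube involves the constant term, which is bounded by \<open>K\<close> and
    not by \<open>N\<close>; the other coefficients are weakened to \<open>K\<close> using
    \<open>N \<le> 1 \<le> K\<close>.\<close>
  have 3: "cmod (fps_nth (H ^ 3) n) \<le> 9 * K ^ 3 * R ^ n"
  proof (rule norm_fps_power3_nth_le)
    fix k assume "1 \<le> k" "k \<le> n"
    hence "cmod (fps_nth H k) \<le> N * R ^ k / (real k)\<^sup>2" using b by (simp add: b_def)
    also have "\<dots> \<le> K * R ^ k / (real k)\<^sup>2"
      using N K R by (intro divide_right_mono mult_right_mono) auto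
    finally show "cmod (fps_nth H k) \<le> K * R ^ k / (real k)\<^sup>2" .
  qed (use K R in auto)
  have 4: "cmod (fps_nth (1 :: complex fps) n) \<le> R ^ n"
    using R by (cases n) auto
  \<comment> \<open>Replacing the modulus of \<open>b 0\<close> by its lower bound \<open>m\<close>
    isolates the new coefficient in the recurrence.\<close>
  have "(real (Suc n))\<^sup>2 * cmod (b (Suc n)) * m \<le> (real (Suc n))\<^sup>2 * cmod (b (Suc n)) * cmod (b 0)"
    using m by (intro mult_left_mono) (auto simp: b_def)
  also have "\<dots> = cmod ((of_nat (Suc n))\<^sup>2 * b (Suc n) * b 0)"
    by (simp add: norm_mult norm_power del: of_nat_Suc)
  also have "(of_nat (Suc n))\<^sup>2 * b (Suc n) * b 0 = ode_rest H n"
    using solves_ode_iff_recurrence[of H] sol \<open>b 0 \<noteq> 0\<close> unfolding b_def by blast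
  also have "\<dots> = fps_nth (fps_X * (fps_deriv H)\<^sup>2) n + fps_nth (H ^ 3) n - fps_nth 1 n
      - (\<Sum>k<n. (of_nat (Suc k))\<^sup>2 * b (Suc k) * b (n - k))"
    by (simp only: ode_rest_def b_def fps_add_nth fps_sub_nth)
  also have "cmod \<dots> \<le> Q * 2 + 9 * K ^ 3 * R ^ n + R ^ n + Q * 2"
    by (rule order_trans[OF norm_triangle_ineq4 add_mono[OF order_trans[OF norm_triangle_ineq4
          add_mono[OF order_trans[OF norm_triangle_ineq add_mono[OF 2 3]] 4]] 1]])
  also have "\<dots> = (4 * N\<^sup>2 * R + (9 * K ^ 3 + 1)) * R ^ n"
    by (simp add: Q_def algebra_simps)
  also have "\<dots> < m * N * R * R ^ n"
    using small R by (intro mult_strict_right_mono) auto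
  finally have "(real (Suc n))\<^sup>2 * cmod (b (Suc n)) < N * R ^ Suc n"
    using m by (simp add: mult_ac)
  thus ?case
    by (simp add: n' b_def pos_less_divide_eq mult.commute del: of_nat_Suc)
qed

lemma coeff_bound_exists:
  assumes "compact D" and "D \<subseteq> - {0}"
  shows "\<exists>N>0. \<exists>R>0. coeff_bound D N R"
proof -
  \<comment> \<open>A closed set that avoids 0 has positive distance from it.\<close>
  obtain m where m: "m > 0" "\<And>a. a \<in> D \<Longrightarrow> m \<le> cmod a"
    using separate_point_closed[of D 0] compact_imp_closed[OF assms(1)] assms(2)
    by (auto simp: dist_norm)
  obtain M where M: "\<And>a. a \<in> D \<Longrightarrow> cmod a \<le> M"
    using compact_imp_bounded[OF assms(1)] by (auto simp: bounded_iff)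
  define K where "K = max 1 M"
  \<comment> \<open>With \<open>8 * N \<le> m\<close> the quadratic term takes at most half of
    \<open>m * N * R\<close>; the choice of \<open>R\<close> leaves at most a quarter to
    \<open>9 * K ^ 3 + 1\<close>, so the inequality is strict.\<close>
  define N where "N = min 1 (m / 8)"
  define R where "R = max 1 (4 * (9 * K ^ 3 + 1) / (m * N))"
  have K: "K \<ge> 1" and N: "N > 0" "N \<le> 1" "8 * N \<le> m" and R: "R \<ge> 1"
    using m by (auto simp: K_def N_def R_def)
  have "4 * N\<^sup>2 * R \<le> m * N * R / 2"
    using mult_right_mono[OF N(3), of "N * R"] N R by (simp add: power2_eq_square mult_ac)
  moreover have "4 * (9 * K ^ 3 + 1) / (m * N) \<le> R" by (simp add: R_def)
  hence "4 * (9 * K ^ 3 + 1) \<le> m * N * R"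
    using m N by (simp add: pos_divide_le_eq mult_ac)
  moreover have "K ^ 3 > 0" using K by simp
  ultimately have small: "4 * N\<^sup>2 * R + (9 * K ^ 3 + 1) < m * N * R" by argo
  have "coeff_bound D N R"
    unfolding coeff_bound_def
  proof (intro allI impI ballI)
    fix n :: nat and a0 assume "1 \<le> n" "a0 \<in> D"
    moreover have "a0 \<noteq> 0" using \<open>a0 \<in> D\<close> assms(2) by auto
    ultimately show "cmod (fps_nth (H_series a0) n) < N * R ^ n / (real n)\<^sup>2"
      using m M[of a0] K N R small H_series[of a0]
      by (intro solves_ode_coeff_bound[of _ m K]) (auto simp: K_def)
  qed
  thus ?thesis using N R by (intro exI[of _ N] exI[of _ R] conjI) auto
qed

section \<open>Uniform convergence\<close>

text \<open>On the disc the growth \<open>R ^ k\<close> is cancelled by \<open>r ^ k\<close>, which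
  leaves the summable majorant N/k^2. It depends on neither \<open>a0\<close> nor \<open>r\<close>,
  so the Weierstrass test gives uniformity jointly in both, up to the rim of the disc.\<close>

lemma coeff_bound_imp_uniformly_convergent_on:
  assumes "bounded D" "0 \<notin> D" and R: "R > 0" and N: "N > 0" and bound: "coeff_bound D N R"
  shows "uniformly_convergent_on (D \<times> ball 0 (1 / R))
    (\<lambda>m (a0, r). \<Sum>k\<le>m. fps_nth (H_series a0) k * r ^ k)"
proof -
  obtain M where M: "\<And>a. a \<in> D \<Longrightarrow> cmod a \<le> M"
    using assms(1) by (auto simp: bounded_iff)
  \<comment> \<open>\<open>coeff_bound\<close> starts at index 1; the constant term
    \<open>- a0\<close> is majorised by the bound \<open>M\<close> on \<open>D\<close>.\<close>
  define B where "B = (\<lambda>k. if k = 0 then M else N * (1 / (real k)\<^sup>2))"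
  have "summable (\<lambda>k. N * (1 / (real k)\<^sup>2))"
    using inverse_power_summable[of 2, where 'a = real]
    by (intro summable_mult) (simp add: field_simps)
  moreover have "eventually (\<lambda>k. B k = N * (1 / (real k)\<^sup>2)) sequentially"
    using eventually_gt_at_top[of 0] by eventually_elim (simp add: B_def)
  ultimately have B: "summable B" by (simp only: summable_cong)
  define f where "f = (\<lambda>k (a0 :: complex, r). fps_nth (H_series a0) k * r ^ k)"
  have "uniformly_convergent_on (D \<times> ball 0 (1 / R)) (\<lambda>n x. \<Sum>k<n. f k x)"
  proof (rule Weierstrass_m_test'[OF _ B])
    fix k x assume "x \<in> D \<times> ball (0 :: complex) (1 / R)"
    then obtain a0 r where x: "x = (a0, r)" and a0: "a0 \<in> D" and r: "cmod r < 1 / R" by auto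
    show "norm (f k x) \<le> B k"
    proof (cases k)
      case 0
      have "a0 \<noteq> 0" using a0 assms(2) by auto
      thus ?thesis using 0 M[OF a0] H_series(1)[of a0] by (simp add: f_def x B_def)
    next
      case (Suc j)
      hence "1 \<le> k" by simp
      hence "cmod (fps_nth (H_series a0) k) \<le> N * R ^ k / (real k)\<^sup>2"
        using bound a0 unfolding coeff_bound_def by (blast intro: less_imp_le)
      hence "norm (f k x) \<le> (N * R ^ k / (real k)\<^sup>2) * (1 / R) ^ k"
        unfolding f_def x prod.case norm_mult norm_power using r N R
        by (intro mult_mono power_mono) auto
      also have "\<dots> = B k" using R Suc by (simp add: B_def power_one_over)
      finally show ?thesis .
    qed
  qed
  then obtain l where "uniform_limit (D \<times> ball 0 (1 / R)) (\<lambda>n x. \<Sum>k<n. f k x) l sequentially"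
    by (auto simp: uniformly_convergent_on_def)
  \<comment> \<open>The test speaks of sums over \<open>k<n\<close>; composing with
    \<open>Suc\<close> turns them into sums over \<open>k\<le>n\<close>.\<close>
  hence "uniform_limit (D \<times> ball 0 (1 / R)) (\<lambda>n x. \<Sum>k<Suc n. f k x) l sequentially"
    by (rule filterlim_compose[OF _ filterlim_Suc])
  hence "uniformly_convergent_on (D \<times> ball 0 (1 / R)) (\<lambda>n x. \<Sum>k<Suc n. f k x)"
    by (auto simp: uniformly_convergent_on_def)
  thus ?thesis by (simp only: f_def lessThan_Suc_atMost case_prod_unfold)
qed

theorem corollary2p1:
  fixes D :: "complex set"
  assumes "compact D" and "D \<subseteq> - {0}"
  shows "(\<forall>R>0. (\<exists>N>0. coeff_bound D N R) \<longrightarrow>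
            uniformly_convergent_on (D \<times> ball 0 (1 / R))
              (\<lambda>m (a0, r). \<Sum>k\<le>m. fps_nth (H_series a0) k * r ^ k))
       \<and> (\<exists>N>0. \<exists>R>0. coeff_bound D N R)"
  using coeff_bound_imp_uniformly_convergent_on[OF compact_imp_bounded[OF assms(1)]]
    coeff_bound_exists[OF assms] assms(2) by blast

end
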